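(* Let $m,q\ge 2$ be integers and let $$\lambda = M_{mq}^{s_k}R_{mq}^{t_k}\cdots M_{mq}^{s_1}R_{mq}^{t_1}(1)_m$$ be a conjugate $(m,q)$-ary partition. Then $$\lambda' = M_{qm}^{t_1}R_{qm}^{s_1}\cdots M_{qm}^{t_k}R_{qm}^{s_k}(1)_q$$ is its conjugate $(q,m)$-ary partition.
   Context: Let $m,q\ge 2$ be integers. A partition $\lambda$ of a positive integer $n$ is $m$-ary if all its parts are powers $m^i$, $i\ge 0$ (so $m^0=1$ is allowed). If $a_i$ is the number of times the part $m^i$ appears in $\lambda$, one writes $\lambda=(a_k,a_{k-1},\ldots,a_0)_m$, where $a_k\neq 0$ and $a_i=0$ for $i>k$. The conjugate $\lambda'$ is obtained by reflecting the Ferrers diagram across the main diagonal. $\lambda$ is conjugate $(m,q)$-ary if $\lambda$ is $m$-ary and $\lambda'$ is $q$-ary; equivalently, $\lambda$ is $m$-ary and each partial sum $\sum_{i=r}^k a_i$, $0\le r\le k$, is a power of $q$ (with $q^0=1$ allowed). For a conjugate $(m,q)$-ary partition $\lambda=(a_k,\ldots,a_0)_m$, define the operators (each producing a conjugate $(m,q)$-ary partition): raise $R_{mq}(\lambda)=(qa_k,qa_{k-1},\ldots,qa_0)_m$ and migration $M_{mq}(\lambda)=(1,a_k-1,a_{k-1},\ldots,a_0)_m$. The operators $R_{qm},M_{qm}$ are the same operators with the roles of $m$ and $q$ exchanged, acting on conjugate $(q,m)$-ary partitions $(b_\ell,\ldots,b_0)_q$: $R_{qm}(b_\ell,\ldots,b_0)_q=(mb_\ell,\ldots,mb_0)_q$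 and $M_{qm}(b_\ell,\ldots,b_0)_q=(1,b_\ell-1,b_{\ell-1},\ldots,b_0)_q$. Sequences of operators are composed as functions (rightmost applied first), exponents are non-negative integers, and $(1)_m=(1)_q$ is the trivial partition of $1$. *)

theory Defs
  imports Main
begin

text \<open>A partition of a positive integer, as the weakly decreasing list of its parts.\<close>

definition is_partition :: "nat list \<Rightarrow> bool" where
  "is_partition xs \<longleftrightarrow> xs \<noteq> [] \<and> sorted_wrt (\<ge>) xs \<and> (\<forall>p \<in> set xs. 0 < p)"

text \<open>Rows and columns are counted from 0; the main diagonal consists of the cells \<open>(i, i)\<close>,
  so reflecting a diagram across it is taking the converse relation.\<close>

definition ferrers :: "nat list \<Rightarrow> (nat \<times> nat) set" where
  "ferrers xs = {(i, j). i < length xs \<and> j < xs ! i}"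

definition conjugate :: "nat list \<Rightarrow> nat list" where
  "conjugate xs = (THE ys. is_partition ys \<and> ferrers ys = (ferrers xs)\<inverse>)"

lemma ferrers_inject:
  assumes "is_partition xs" "is_partition ys" "ferrers xs = ferrers ys"
  shows "xs = ys"
proof (rule nth_equalityI)
  have *: "i < length zs \<longleftrightarrow> (i, 0) \<in> ferrers zs" if "is_partition zs" for zs i
    using that by (auto simp: ferrers_def is_partition_def)
  have "i < length xs \<longleftrightarrow> i < length ys" for i
    using * assms by metis
  then show len: "length xs = length ys"
    by (meson linorder_neqE_nat less_irrefl)
  fix i assume "i < length xs"
  then have "j < xs ! i \<longleftrightarrow> j < ys ! i" for j
    using assms(3) len by (auto simp: ferrers_def set_eq_iff)
  then show "xs ! i = ys ! i"
    by (meson linorder_neqE_nat less_irrefl)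
qed

lemma less_length_filter_sorted_iff:
  fixes xs :: "nat list"
  assumes "sorted_wrt (\<ge>) xs"
  shows "i < length (filter (\<lambda>p. j < p) xs) \<longleftrightarrow> i < length xs \<and> j < xs ! i"
  using assms
proof (induction xs arbitrary: i)
  case (Cons x xs)
  show ?case
  proof (cases "j < x")
    case True
    with Cons show ?thesis by (cases i) auto
  next
    case False
    then have small: "\<forall>y \<in> set (x # xs). \<not> j < y" using Cons.prems by auto
    then have "filter (\<lambda>p. j < p) (x # xs) = []"
      by (metis filter_False)
    with small show ?thesis by (metis length_0_conv not_less0 nth_mem)
  qed
qed simp

lemma ex_conjugate:
  assumes "is_partition xs"
  shows "\<exists>ys. is_partition ys \<and> ferrers ys = (ferrers xs)\<inverse>"
proof -
  define c where "c j = length (filter (\<lambda>p. j < p) xs)" for j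
  define ys where "ys = map c [0..<hd xs]"
  have srt: "sorted_wrt (\<ge>) xs" and ne: "xs \<noteq> []" and pos: "0 < hd xs"
    using assms by (auto simp: is_partition_def)
  have c: "i < c j \<longleftrightarrow> i < length xs \<and> j < xs ! i" for i j
    unfolding c_def using less_length_filter_sorted_iff[OF srt] .
  have mono: "c j' \<le> c j" if "j \<le> j'" for j j'
    using c that by (meson leI le_less_trans less_irrefl)
  have hd: "xs ! i \<le> hd xs" if "i < length xs" for i
    using srt ne that by (cases xs; cases i) auto
  have "0 < c j" if "j < hd xs" for j
    using c ne that by (simp add: hd_conv_nth)
  then have "is_partition ys"
    using pos mono by (auto simp: is_partition_def ys_def sorted_wrt_iff_nth_less)
  moreover have "ferrers ys = (ferrers xs)\<inverse>"
    using c hd by (fastforce simp: ferrers_def ys_def)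
  ultimately show ?thesis by blast
qed

lemma conjugate:
  assumes "is_partition xs"
  shows "is_partition (conjugate xs)" and "ferrers (conjugate xs) = (ferrers xs)\<inverse>"
proof -
  have "\<exists>!ys. is_partition ys \<and> ferrers ys = (ferrers xs)\<inverse>"
    using ex_conjugate[OF assms] ferrers_inject by metis
  from theI'[OF this]
  show "is_partition (conjugate xs)" and "ferrers (conjugate xs) = (ferrers xs)\<inverse>"
    by (simp_all add: conjugate_def)
qed

definition is_ary :: "nat \<Rightarrow> nat list \<Rightarrow> bool" where
  "is_ary m xs \<longleftrightarrow> is_partition xs \<and> (\<forall>p \<in> set xs. \<exists>i. p = m ^ i)"

definition is_conjugate_ary :: "nat \<Rightarrow> nat \<Rightarrow> nat list \<Rightarrow> bool" where
  "is_conjugate_ary m q xs \<longleftrightarrow> is_ary m xs \<and> is_ary q (conjugate xs)"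

text \<open>\<open>ary m [a\<^sub>k, \<dots>, a\<^sub>0]\<close> is the partition \<open>(a\<^sub>k, \<dots>, a\<^sub>0)\<^sub>m\<close>, in which the part \<open>m ^ i\<close> appears
  \<open>a\<^sub>i\<close> times.\<close>

fun ary :: "nat \<Rightarrow> nat list \<Rightarrow> nat list" where
  "ary m [] = []"
| "ary m (a # as) = replicate a (m ^ length as) @ ary m as"

text \<open>The coefficients \<open>[a\<^sub>k, \<dots>, a\<^sub>0]\<close> of an \<open>m\<close>-ary partition, where \<open>k\<close> is the largest index
  with \<open>a\<^sub>k \<noteq> 0\<close>.\<close>

definition coeffs :: "nat \<Rightarrow> nat list \<Rightarrow> nat list" where
  "coeffs m xs = map (\<lambda>i. count_list xs (m ^ i)) (rev [0..<Suc (GREATEST i. m ^ i \<in> set xs)])"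

definition raise_op :: "nat \<Rightarrow> nat \<Rightarrow> nat list \<Rightarrow> nat list" where
  "raise_op m q xs = ary m (map (\<lambda>a. q * a) (coeffs m xs))"

text \<open>The migration operator does not depend on \<open>q\<close>, which is kept to match the notation
  \<open>M\<^sub>m\<^sub>q\<close>. The list \<open>coeffs m xs\<close> is never empty.\<close>

definition migrate_op :: "nat \<Rightarrow> nat \<Rightarrow> nat list \<Rightarrow> nat list" where
  "migrate_op m q xs = ary m (1 # (hd (coeffs m xs) - 1) # tl (coeffs m xs))"

end

theory Submission
  imports Defs
begin

text \<open>On a normalized coefficient list, raising repeats every row of the diagram \<open>q\<close> times and
  migration lengthens the top row by the factor \<open>m\<close>. Reflected across the diagonal, these become
  the operations ``multiply every part by \<open>q\<close>'' and ``make the leftmost column \<open>m\<close> times as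
  tall'', that is, append parts \<open>1\<close>. In general neither of the reflected operations is a raise or
  a migration of the conjugate partition, but each of them commutes with every raise and migration
  (\<open>scale_parts_commutes\<close>, \<open>tall_first_column_commutes\<close>), and on the one-cell diagram the
  first agrees with a migration and the second with a raise (\<open>reflected_word_one\<close>). So
  conjugating turns a newly applied outermost factor \<open>M\<^sup>s R\<^sup>t\<close> of the word into reflected operations which travel through the word
  built so far to its innermost end, where they become a factor \<open>M\<^sup>t R\<^sup>s\<close>. This is why
  the order of the factors is reversed; the theorem is an induction on their number
  (\<open>conjugate_fold_repeat_widen\<close>).\<close>

section \<open>The operators as operations on rows\<close>

definition repeat_parts :: "nat \<Rightarrow> nat list \<Rightarrow> nat list" where
  "repeat_parts q xs = concat (map (replicate q) xs)"

text \<open>The empty list is a fixed point so that the commutation laws below hold for all lists.\<close>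

fun widen_top :: "nat \<Rightarrow> nat list \<Rightarrow> nat list" where
  "widen_top m [] = []"
| "widen_top m (x # xs) = (m * x) # xs"

definition scale_parts :: "nat \<Rightarrow> nat list \<Rightarrow> nat list" where
  "scale_parts q xs = map ((*) q) xs"

definition tall_first_column :: "nat \<Rightarrow> nat list \<Rightarrow> nat list" where
  "tall_first_column m xs = xs @ replicate ((m - 1) * length xs) 1"

text \<open>A nonzero leading entry makes \<open>coeffs m\<close> undo \<open>ary m\<close> (\<open>coeffs_ary\<close>), and both operators
  keep it nonzero. So on partitions of this form their effect can be read off from the coefficient
  list.\<close>

definition normal_ary :: "nat \<Rightarrow> nat list \<Rightarrow> bool" where
  "normal_ary m xs \<longleftrightarrow> (\<exists>a as. 0 < a \<and> xs = ary m (a # as))"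

lemma set_ary: "p \<in> set (ary m as) \<Longrightarrow> \<exists>i < length as. p = m ^ i"
  by (induction as) (auto split: if_splits intro: less_SucI)

lemma sorted_wrt_replicate: "sorted_wrt (\<ge>) (replicate n (x :: nat))"
  by (induction n) auto

lemma normal_ary_imp_is_ary:
  assumes "2 \<le> m" "normal_ary m xs"
  shows "is_ary m xs"
proof -
  have srt: "sorted_wrt (\<ge>) (ary m as)" for as
  proof (induction as)
    case (Cons a as)
    have "p \<le> m ^ length as" if "p \<in> set (ary m as)" for p
      using set_ary[OF that] assms(1) by (auto intro: power_increasing)
    with Cons show ?case by (auto simp: sorted_wrt_append sorted_wrt_replicate)
  qed simp
  have pow: "\<exists>i. p = m ^ i" if "p \<in> set xs" for p
    using set_ary that assms(2) by (fastforce simp: normal_ary_def simp del: ary.simps)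
  moreover have "xs \<noteq> []"
    using assms(2) by (auto simp: normal_ary_def)
  moreover have "sorted_wrt (\<ge>) xs"
    using assms(2) srt by (auto simp: normal_ary_def simp del: ary.simps)
  moreover have "0 < p" if "p \<in> set xs" for p
    using pow[OF that] assms(1) by auto
  ultimately show ?thesis by (auto simp: is_ary_def is_partition_def)
qed

lemma count_list_replicate:
  "count_list (replicate n x) y = (if x = y then n else 0)"
  by (induction n) auto

lemma count_list_ary:
  assumes "2 \<le> m"
  shows "count_list (ary m as) (m ^ i) = (if i < length as then rev as ! i else 0)"
  using assms by (induction as) (auto simp: count_list_replicate nth_append)

lemma coeffs_ary:
  assumes "2 \<le> m" "0 < a"
  shows "coeffs m (ary m (a # as)) = a # as"
proof -
  have "(GREATEST i. m ^ i \<in> set (ary m (a # as))) = length as"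
  proof (rule Greatest_equality)
    show "m ^ length as \<in> set (ary m (a # as))" using assms by simp
    show "i \<le> length as" if "m ^ i \<in> set (ary m (a # as))" for i
      using set_ary[OF that] assms(1) by auto
  qed
  then have "coeffs m (ary m (a # as)) = map ((!) (rev (a # as))) (rev [0..<length (a # as)])"
    unfolding coeffs_def by (auto simp: count_list_ary[OF assms(1)] simp del: ary.simps)
  also have "\<dots> = rev (map ((!) (rev (a # as))) [0..<length (rev (a # as))])"
    by (simp only: rev_map length_rev)
  also have "\<dots> = a # as"
    by (simp only: map_nth rev_rev_ident)
  finally show ?thesis .
qed

lemma raise_op_normal:
  assumes "2 \<le> m" "0 < q" "normal_ary m xs"
  shows "raise_op m q xs = repeat_parts q xs" "normal_ary m (raise_op m q xs)"
proof -
  have rep: "concat (replicate b (replicate q p)) = replicate (q * b) p" for b :: nat and p :: nat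
    by (induction b) (auto simp: replicate_add)
  have *: "ary m (map ((*) q) as) = repeat_parts q (ary m as)" for as
    by (induction as) (auto simp: repeat_parts_def rep)
  obtain a as where a: "0 < a" "xs = ary m (a # as)"
    using assms(3) by (auto simp: normal_ary_def)
  then have r: "raise_op m q xs = ary m (map ((*) q) (a # as))"
    using coeffs_ary[OF assms(1)] by (simp add: raise_op_def del: ary.simps)
  then show "raise_op m q xs = repeat_parts q xs"
    using a * by (simp del: ary.simps list.map)
  show "normal_ary m (raise_op m q xs)"
    unfolding normal_ary_def
    using r a(1) assms(2) by (intro exI[of _ "q * a"] exI[of _ "map ((*) q) as"]) simp
qed

lemma migrate_op_normal:
  assumes "2 \<le> m" "normal_ary m xs"
  shows "migrate_op m q xs = widen_top m xs" "normal_ary m (migrate_op m q xs)"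
proof -
  obtain a as where a: "0 < a" "xs = ary m (a # as)"
    using assms(2) by (auto simp: normal_ary_def)
  then have r: "migrate_op m q xs = ary m (1 # (a - 1) # as)"
    using coeffs_ary[OF assms(1)] by (simp add: migrate_op_def del: ary.simps)
  show "migrate_op m q xs = widen_top m xs"
    using r a by (cases a) auto
  show "normal_ary m (migrate_op m q xs)"
    unfolding normal_ary_def r by blast
qed

lemma operator_word_normal:
  assumes "2 \<le> m" "0 < q" "normal_ary m xs"
  shows "((migrate_op m q ^^ a) \<circ> (raise_op m q ^^ b)) xs
      = ((widen_top m ^^ a) \<circ> (repeat_parts q ^^ b)) xs"
    and "normal_ary m (((migrate_op m q ^^ a) \<circ> (raise_op m q ^^ b)) xs)"
proof -
  have r: "(raise_op m q ^^ n) xs = (repeat_parts q ^^ n) xs \<and> normal_ary m ((raise_op m q ^^ n) xs)"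
    for n
    using assms raise_op_normal[OF assms(1,2)] by (induction n) auto
  have mg: "(migrate_op m q ^^ n) ys = (widen_top m ^^ n) ys \<and> normal_ary m ((migrate_op m q ^^ n) ys)"
    if "normal_ary m ys" for n ys
    using that migrate_op_normal[OF assms(1)] by (induction n) auto
  show "((migrate_op m q ^^ a) \<circ> (raise_op m q ^^ b)) xs
      = ((widen_top m ^^ a) \<circ> (repeat_parts q ^^ b)) xs"
    using r mg by (metis comp_apply)
  show "normal_ary m (((migrate_op m q ^^ a) \<circ> (raise_op m q ^^ b)) xs)"
    using r mg by (metis comp_apply)
qed

lemma fold_operators_normal:
  assumes "2 \<le> m" "0 < q" "normal_ary m xs"
  shows "fold (\<lambda>i. (migrate_op m q ^^ s i) \<circ> (raise_op m q ^^ t i)) is xs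
      = fold (\<lambda>i. (widen_top m ^^ s i) \<circ> (repeat_parts q ^^ t i)) is xs
    \<and> normal_ary m (fold (\<lambda>i. (migrate_op m q ^^ s i) \<circ> (raise_op m q ^^ t i)) is xs)"
  using assms(3)
proof (induction "is" arbitrary: xs)
  case (Cons i "is")
  show ?case
    using Cons.IH[OF operator_word_normal(2)[OF assms(1,2) Cons.prems, of "s i" "t i"]]
    unfolding fold_simps operator_word_normal(1)[OF assms(1,2) Cons.prems] .
qed simp

section \<open>Reflected operations\<close>

lemma nth_repeat_parts:
  assumes "0 < q"
  shows "length (repeat_parts q xs) = q * length xs"
    and "i < q * length xs \<Longrightarrow> repeat_parts q xs ! i = xs ! (i div q)"
proof -
  show len: "length (repeat_parts q xs) = q * length xs" for xs
    by (induction xs) (auto simp: repeat_parts_def)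
  show "i < q * length xs \<Longrightarrow> repeat_parts q xs ! i = xs ! (i div q)"
  proof (induction xs arbitrary: i)
    case (Cons x xs)
    show ?case
    proof (cases "i < q")
      case True
      then show ?thesis by (simp add: repeat_parts_def nth_append)
    next
      case False
      then have "repeat_parts q (x # xs) ! i = repeat_parts q xs ! (i - q)"
        by (simp add: repeat_parts_def nth_append)
      also have "\<dots> = xs ! ((i - q) div q)"
        using Cons False by auto
      finally show ?thesis
        using False assms by (simp add: le_div_geq)
    qed
  qed simp
qed

text \<open>Each operation stretches the diagram, or only its first row or column, along one axis, so
  its cells are the preimage of the old ones under a division in one coordinate. In this form the
  reflection just exchanges the coordinates.\<close>

lemma ferrers_repeat_parts:
  assumes "0 < q"
  shows "ferrers (repeat_parts q xs) = {(i, j). (i div q, j) \<in> ferrers xs}"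
  using nth_repeat_parts[OF assms] assms
  by (auto simp: ferrers_def less_mult_imp_div_less mult.commute div_less_iff_less_mult)

lemma ferrers_scale_parts:
  assumes "0 < q"
  shows "ferrers (scale_parts q xs) = {(i, j). (i, j div q) \<in> ferrers xs}"
  using assms by (auto simp: ferrers_def scale_parts_def div_less_iff_less_mult mult.commute)

lemma ferrers_widen_top:
  assumes "0 < m"
  shows "ferrers (widen_top m xs)
    = {(i, j). if i = 0 then (0, j div m) \<in> ferrers xs else (i, j) \<in> ferrers xs}"
  using assms
  by (cases xs) (auto simp: ferrers_def div_less_iff_less_mult mult.commute nth_Cons')

text \<open>Since a partition has no part \<open>0\<close>, its first column is full, and the appended cells
  continue it without a gap.\<close>

lemma ferrers_tall_first_column:
  assumes "0 < m" "is_partition xs"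
  shows "ferrers (tall_first_column m xs)
    = {(i, j). if j = 0 then (i div m, 0) \<in> ferrers xs else (i, j) \<in> ferrers xs}"
proof -
  have len: "length (tall_first_column m xs) = m * length xs"
    using assms(1) by (cases m) (auto simp: tall_first_column_def)
  have lt: "i < m * length xs" if "i < length xs" for i
    using mult_le_mono1[of 1 m "length xs"] that assms(1) by linarith
  have nth: "tall_first_column m xs ! i = (if i < length xs then xs ! i else 1)"
    if "i < m * length xs" for i
    using that len by (auto simp: tall_first_column_def nth_append)
  have pos: "0 < xs ! i" if "i < length xs" for i
    using assms(2) that by (auto simp: is_partition_def)
  have dv: "i div m < length xs \<longleftrightarrow> i < m * length xs" for i
    using assms(1) by (simp add: div_less_iff_less_mult mult.commute)
  show ?thesis
    using nth pos lt dv unfolding ferrers_def len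
    by (auto split: if_splits)
qed

lemma is_partition_operations:
  assumes "0 < m" "is_partition xs"
  shows "is_partition (repeat_parts m xs)" "is_partition (widen_top m xs)"
    "is_partition (scale_parts m xs)" "is_partition (tall_first_column m xs)"
proof -
  have srt: "sorted_wrt (\<ge>) xs" and pos: "\<forall>p \<in> set xs. 0 < p" and ne: "xs \<noteq> []"
    using assms(2) by (auto simp: is_partition_def)
  have set_rep: "set (repeat_parts m ys) = set ys" for ys
    using assms(1) by (auto simp: repeat_parts_def)
  have "sorted_wrt (\<ge>) (repeat_parts m xs)"
    using srt
  proof (induction xs)
    case (Cons x xs)
    then show ?case
      using set_rep[of xs]
      by (auto simp: repeat_parts_def sorted_wrt_append sorted_wrt_replicate)
  qed (simp add: repeat_parts_def)
  then show "is_partition (repeat_parts m xs)"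
    using pos ne set_rep[of xs] by (auto simp: is_partition_def simp flip: set_empty)
  have "y \<le> m * x" if "y \<le> x" for x y
    using mult_le_mono[of 1 m y x] that assms(1) by simp
  then show "is_partition (widen_top m xs)"
    using srt pos ne assms(1) by (cases xs) (auto simp: is_partition_def)
  show "is_partition (scale_parts m xs)"
    using srt pos ne assms(1)
    by (auto simp: is_partition_def scale_parts_def sorted_wrt_map elim: sorted_wrt_mono_rel[rotated])
  show "is_partition (tall_first_column m xs)"
    using srt pos ne
    by (auto simp: is_partition_def tall_first_column_def sorted_wrt_append Suc_leI
        sorted_wrt_replicate)
qed

lemma conjugate_eqI:
  assumes "is_partition xs" "is_partition ys" "ferrers ys = (ferrers xs)\<inverse>"
  shows "conjugate xs = ys"
  using ferrers_inject conjugate[OF assms(1)] assms by metis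

lemma conjugate_conjugate: "is_partition xs \<Longrightarrow> conjugate (conjugate xs) = xs"
  by (rule conjugate_eqI) (simp_all add: conjugate)

lemma conjugate_repeat_parts:
  assumes "0 < q" "is_partition xs"
  shows "conjugate (repeat_parts q xs) = scale_parts q (conjugate xs)"
  using assms by (intro conjugate_eqI)
    (auto simp: is_partition_operations conjugate ferrers_repeat_parts ferrers_scale_parts)

lemma conjugate_widen_top:
  assumes "0 < m" "is_partition xs"
  shows "conjugate (widen_top m xs) = tall_first_column m (conjugate xs)"
  using assms by (intro conjugate_eqI)
    (auto simp: is_partition_operations conjugate ferrers_widen_top ferrers_tall_first_column
      split: if_splits)

lemma conjugate_word:
  assumes "0 < m" "0 < q" "is_partition xs"
  shows "conjugate (((widen_top m ^^ a) \<circ> (repeat_parts q ^^ b)) xs)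
      = ((tall_first_column m ^^ a) \<circ> (scale_parts q ^^ b)) (conjugate xs)"
    and "is_partition (((widen_top m ^^ a) \<circ> (repeat_parts q ^^ b)) xs)"
proof -
  have r: "is_partition ((repeat_parts q ^^ n) xs)
      \<and> conjugate ((repeat_parts q ^^ n) xs) = (scale_parts q ^^ n) (conjugate xs)" for n
    using assms by (induction n) (auto simp: is_partition_operations conjugate_repeat_parts)
  have w: "is_partition ((widen_top m ^^ n) ys)
      \<and> conjugate ((widen_top m ^^ n) ys) = (tall_first_column m ^^ n) (conjugate ys)"
    if "is_partition ys" for n ys
    using assms(1) that by (induction n) (auto simp: is_partition_operations conjugate_widen_top)
  show "conjugate (((widen_top m ^^ a) \<circ> (repeat_parts q ^^ b)) xs)
      = ((tall_first_column m ^^ a) \<circ> (scale_parts q ^^ b)) (conjugate xs)"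
    and "is_partition (((widen_top m ^^ a) \<circ> (repeat_parts q ^^ b)) xs)"
    using r w by simp_all
qed

section \<open>Commutation and reversal of the word\<close>

lemma scale_parts_commutes:
  "scale_parts c \<circ> widen_top d = widen_top d \<circ> scale_parts c"
  "scale_parts c \<circ> repeat_parts d = repeat_parts d \<circ> scale_parts c"
proof -
  show "scale_parts c \<circ> widen_top d = widen_top d \<circ> scale_parts c"
  proof
    show "(scale_parts c \<circ> widen_top d) xs = (widen_top d \<circ> scale_parts c) xs" for xs
      by (cases xs) (auto simp: scale_parts_def)
  qed
  show "scale_parts c \<circ> repeat_parts d = repeat_parts d \<circ> scale_parts c"
    by (rule ext) (simp add: scale_parts_def repeat_parts_def map_concat comp_def)
qed

text \<open>Repeating parts multiplies both the number of parts and the number of appended parts \<open>1\<close>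
  by the same factor, and widening the top row of a nonempty diagram changes neither.\<close>

lemma tall_first_column_commutes:
  "tall_first_column c \<circ> widen_top d = widen_top d \<circ> tall_first_column c"
  "tall_first_column c \<circ> repeat_parts d = repeat_parts d \<circ> tall_first_column c"
proof -
  show "tall_first_column c \<circ> widen_top d = widen_top d \<circ> tall_first_column c"
  proof
    show "(tall_first_column c \<circ> widen_top d) xs = (widen_top d \<circ> tall_first_column c) xs" for xs
      by (cases xs) (auto simp: tall_first_column_def)
  qed
  have rep: "repeat_parts d (replicate n x) = replicate (n * d) x" for n x
    by (induction n) (auto simp: repeat_parts_def replicate_add)
  have app: "repeat_parts d (xs @ ys) = repeat_parts d xs @ repeat_parts d ys" for xs ys
    by (simp add: repeat_parts_def)
  have len: "length (repeat_parts d xs) = length xs * d" for xs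
    by (induction xs) (auto simp: repeat_parts_def)
  show "tall_first_column c \<circ> repeat_parts d = repeat_parts d \<circ> tall_first_column c"
    by (rule ext) (simp add: tall_first_column_def app rep len mult.assoc)
qed

lemma funpow_commutes:
  assumes "f \<circ> g = g \<circ> f"
  shows "(f ^^ n) \<circ> g = g \<circ> (f ^^ n)"
  using assms by (induction n) (auto simp: fun_eq_iff)

text \<open>This carries a reflected operation through a whole word to its innermost end.\<close>

lemma funpow_foldr_commutes:
  assumes "\<And>i. f \<circ> g i = g i \<circ> f" "\<And>i. f \<circ> h i = h i \<circ> f"
  shows "(f ^^ n) (foldr (\<lambda>i. (g i ^^ a i) \<circ> (h i ^^ b i)) is x)
    = foldr (\<lambda>i. (g i ^^ a i) \<circ> (h i ^^ b i)) is ((f ^^ n) x)"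
proof -
  have "(f ^^ n) ((g i ^^ k) y) = (g i ^^ k) ((f ^^ n) y)"
    "(f ^^ n) ((h i ^^ k) y) = (h i ^^ k) ((f ^^ n) y)" for i k y
    using funpow_commutes[OF funpow_commutes[OF assms(1), symmetric], symmetric]
      funpow_commutes[OF funpow_commutes[OF assms(2), symmetric], symmetric]
    by (metis comp_apply)+
  then show ?thesis by (induction "is") auto
qed

text \<open>Scaling a single row by \<open>q\<close> widens its top row, so the inner power becomes a power of
  \<open>widen_top\<close>, past which the column operation commutes. On the one-cell diagram the latter
  repeats the only part; each further power is then moved inside the repetitions made so far.\<close>

lemma reflected_word_one:
  assumes "0 < m"
  shows "((tall_first_column m ^^ a) \<circ> (scale_parts q ^^ b)) [1]
    = ((widen_top q ^^ b) \<circ> (repeat_parts m ^^ a)) [1]"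
proof -
  have sc: "(scale_parts q ^^ b) [1] = (widen_top q ^^ b) [1]"
  proof -
    have "(scale_parts q ^^ b) [1] = [q ^ b] \<and> (widen_top q ^^ b) [1] = [q ^ b]"
      by (induction b) (auto simp: scale_parts_def)
    then show ?thesis by simp
  qed
  have one: "tall_first_column m [1] = repeat_parts m [1]"
    using assms by (cases m) (auto simp: tall_first_column_def repeat_parts_def)
  have tl: "(tall_first_column m ^^ a) [1] = (repeat_parts m ^^ a) [1]"
  proof (induction a)
    case (Suc a)
    have "(tall_first_column m ^^ Suc a) [1] = tall_first_column m ((repeat_parts m ^^ a) [1])"
      using Suc by simp
    also have "\<dots> = (repeat_parts m ^^ a) (tall_first_column m [1])"
      using funpow_commutes[OF tall_first_column_commutes(2)[symmetric]] by (metis comp_apply)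
    also have "\<dots> = (repeat_parts m ^^ Suc a) [1]"
      by (simp only: one funpow_Suc_right comp_apply)
    finally show ?case .
  qed simp
  have "(tall_first_column m ^^ a) ((widen_top q ^^ b) [1])
      = (widen_top q ^^ b) ((tall_first_column m ^^ a) [1])"
    using funpow_commutes[OF funpow_commutes[OF tall_first_column_commutes(1), symmetric]]
    by (metis comp_apply)
  then show ?thesis using sc tl by simp
qed

text \<open>The induction appends to the list of factors because the last factor is outermost in the
  \<open>fold\<close> but innermost in the \<open>foldr\<close>.\<close>

lemma conjugate_fold_repeat_widen:
  assumes "0 < m" "0 < q"
  shows "is_partition (fold (\<lambda>i. (widen_top m ^^ s i) \<circ> (repeat_parts q ^^ t i)) is [1])
    \<and> conjugate (fold (\<lambda>i. (widen_top m ^^ s i) \<circ> (repeat_parts q ^^ t i)) is [1])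
      = foldr (\<lambda>i. (widen_top q ^^ t i) \<circ> (repeat_parts m ^^ s i)) is [1]"
proof (induction "is" rule: rev_induct)
  case Nil
  have "is_partition [1]" by (simp add: is_partition_def)
  moreover have "ferrers [1] = (ferrers [1])\<inverse>" by (auto simp: ferrers_def)
  ultimately show ?case using conjugate_eqI by simp
next
  case (snoc i "is")
  let ?W = "foldr (\<lambda>i. (widen_top q ^^ t i) \<circ> (repeat_parts m ^^ s i)) is"
  let ?x = "fold (\<lambda>i. (widen_top m ^^ s i) \<circ> (repeat_parts q ^^ t i)) is [1]"
  have "conjugate (((widen_top m ^^ s i) \<circ> (repeat_parts q ^^ t i)) ?x)
      = ((tall_first_column m ^^ s i) \<circ> (scale_parts q ^^ t i)) (?W [1])"
    using conjugate_word(1)[OF assms conjunct1[OF snoc], of "s i" "t i"]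
    unfolding conjunct2[OF snoc] .
  also have "\<dots> = ?W (((tall_first_column m ^^ s i) \<circ> (scale_parts q ^^ t i)) [1])"
    by (simp add: funpow_foldr_commutes scale_parts_commutes tall_first_column_commutes)
  also have "\<dots> = ?W (((widen_top q ^^ t i) \<circ> (repeat_parts m ^^ s i)) [1])"
    by (simp only: reflected_word_one[OF assms(1)])
  finally show ?case
    using conjugate_word(2)[OF assms conjunct1[OF snoc], of "s i" "t i"]
    by (simp add: comp_def)
qed

theorem corollary2p12:
  fixes m q k :: nat and s t :: "nat \<Rightarrow> nat" and lam :: "nat list"
  assumes "m \<ge> 2" and "q \<ge> 2"
    and "lam = fold (\<lambda>i. (migrate_op m q ^^ s i) \<circ> (raise_op m q ^^ t i)) [1..<Suc k] (ary m [1])"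
  shows "is_conjugate_ary m q lam
    \<and> conjugate lam = foldr (\<lambda>i. (migrate_op q m ^^ t i) \<circ> (raise_op q m ^^ s i)) [1..<Suc k] (ary q [1])
    \<and> is_conjugate_ary q m (conjugate lam)"
proof -
  let ?r = "foldr (\<lambda>i. (migrate_op q m ^^ t i) \<circ> (raise_op q m ^^ s i)) [1..<Suc k] (ary q [1])"
  have pos: "0 < m" "0 < q" using assms(1,2) by auto
  have one: "normal_ary c (ary c [1])" "ary c [1] = [1]" for c
    by (auto simp: normal_ary_def simp del: ary.simps) auto
  have lam: "lam = fold (\<lambda>i. (widen_top m ^^ s i) \<circ> (repeat_parts q ^^ t i)) [1..<Suc k] [1]"
    "normal_ary m lam"
    using fold_operators_normal[OF assms(1) pos(2) one(1), of s t "[1..<Suc k]"]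
    unfolding assms(3) one(2) by blast+
  have r: "?r = foldr (\<lambda>i. (widen_top q ^^ t i) \<circ> (repeat_parts m ^^ s i)) [1..<Suc k] [1]"
    "normal_ary q ?r"
    \<comment> \<open>The word for the conjugate is the \<open>fold\<close> with the roles exchanged, over the reversed list.\<close>
    using fold_operators_normal[OF assms(2) pos(1) one(1), of t s "rev [1..<Suc k]"]
    unfolding foldr_conv_fold one(2) by blast+
  have conj: "is_partition lam" "conjugate lam = ?r"
    using conjugate_fold_repeat_widen[OF pos, of s t "[1..<Suc k]"]
    unfolding lam(1)[symmetric] r(1)[symmetric] by blast+
  have ary: "is_ary m lam" "is_ary q (conjugate lam)"
    using normal_ary_imp_is_ary assms(1,2) lam(2) r(2) conj(2) by simp_all
  show ?thesis
    using ary conj conjugate_conjugate[OF conj(1)] by (simp add: is_conjugate_ary_def)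
qed

end
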